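(* Let $\{r_t\}_{t\in\mathbb{N}}$ be an i.i.d. sequence of $D$-valued random variables, $D\subseteq\mathbb{R}^p$, on a complete probability space, and consider $$x_{t+1}=x_t+\delta\,S(x_t,z_t,r_t),\qquad z_{t+1}=F(x_t,z_t,r_t),\qquad t\in\mathbb{N},$$ with $S:\mathbb{R}^n\times\mathbb{R}^m\times\mathbb{R}^p\to\mathbb{R}^n$, $F:\mathbb{R}^n\times\mathbb{R}^m\times\mathbb{R}^p\to\mathbb{R}^m$ and $\delta>0$. Suppose the following hold. (1) There are closed sets $X\subseteq\mathbb{R}^n$, $Z\subseteq\mathbb{R}^m$ such that $x+\delta' S(x,z,r)\in X$ and $F(x,z,r)\in Z$ for all $(x,z,r)\in X\times Z\times D$ and $\delta'\in[0,1]$. (2) There is a set-valued map $Z_{\mathrm{FIX}}:X\rightrightarrows Z$ with $Z_{\mathrm{FIX}}(x)$ nonempty and closed for all $x\in X$, such that $\bar z=F(x,\bar z,r)$ for all $r\in D$, $x\in X$, $\bar z\in Z_{\mathrm{FIX}}(x)$; moreover there is $L_{\mathrm{FIX}}>0$ with $d_F(z,Z_{\mathrm{FIX}}(x'))\le L_{\mathrm{FIX}}\,d_S(x,x')$ for all $x,x'\in X$ and $z\in Z_{\mathrm{FIX}}(x)$. (3) There is $c_F\in(0,1)$ with $\mathbb{E}[d_F(F(x,z,r),Z_{\mathrm{FIX}}(x))]\le c_F\,d_F(z,Z_{\mathrm{FIX}}(x))$ for all $(x,z)\in X\times Z$. (4) There is $R:\mathbb{R}^n\times D\to\mathbb{R}^n$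 with $R(x,r)=S(x,z,r)$ for all $x\in X$, $z\in Z_{\mathrm{FIX}}(x)$, $r\in D$. (5) There are $L_S,L_R>0$ with $\|S(x,z,r)-S(x,z',r)\|_S\le L_S\|z-z'\|_F$ and $\|R(x,r)-R(x',r)\|_S\le L_R\|x-x'\|_S$ for all $(x,z),(x',z')\in X\times Z$ and $r\in D$. (6) The set $X_{\mathrm{fix}}:=\{x\in X\mid R(x,r)=0\text{ for all }r\in D\}$ is nonempty and closed, and for some $\alpha\in(0,1)$ and $\mu\ge1$, $$d_S\!\left(x+\tfrac1\alpha R(x,r),\,x'+\tfrac1\alpha R(x',r)\right)\le\|x-x'\|_S,\qquad d_S(x,X_{\mathrm{fix}})\le\mu\,\mathbb{E}[\|R(x,r)\|_S]$$ for all $x,x'\in X$ and (in the first inequality) all $r\in D$. Let $$c_S:=1-\sqrt{1-\frac{1-\alpha}{\alpha\mu^2}},\qquad \bar\delta:=\frac{c_S(1-c_F)}{L_{\mathrm{FIX}}L_S(c_S+L_R)}.$$ Then, for all $\delta\in(0,\min\{\bar\delta,1\})$, there exist $C>0$ and $\rho\in(0,1)$ such that the trajectories satisfy $$\left\|\begin{bmatrix}\mathbb{E}[d_S(x_t,X_{\mathrm{fix}})]\\ \mathbb{E}[d_F(z_t,Z_{\mathrm{FIX}}(x_t))]\end{bmatrix}\right\|\le C\rho^t\left\|\begin{bmatrix}d_S(x_0,X_{\mathrm{fix}})\\ d_F(z_0,Z_{\mathrm{FIX}}(x_0))\end{bmatrix}\right\|$$ for all (deterministic) $(x_0,z_0)\in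 X\times Z$ and $t\in\mathbb{N}$.
   Context: $\|\cdot\|_F$ and $\|\cdot\|_S$ are norms induced by inner products on $\mathbb{R}^m$ and $\mathbb{R}^n$ respectively, with distances $d_F(z,z')=\|z-z'\|_F$ and $d_S(x,x')=\|x-x'\|_S$. For sets, $d_F(z,Z')=\inf_{y\in Z'}d_F(z,y)$ and $d_S(x,X')=\inf_{y\in X'}d_S(x,y)$. $\|\cdot\|$ (no subscript) is the Euclidean norm. In expectations involving $r$ with $x,z$ fixed, $r$ is a random variable with the common law of the $r_t$. The maps are understood to be Borel measurable, so that the expectations are meaningful. The constants $C,\rho$ do not depend on the initial condition or on $t$. *)

theory Defs
  imports "HOL-Probability.Probability"
begin

definition inner_product :: "('a::real_vector \<Rightarrow> 'a \<Rightarrow> real) \<Rightarrow> bool" where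
  "inner_product b \<longleftrightarrow>
     bilinear b \<and> (\<forall>x y. b x y = b y x) \<and> (\<forall>x. x \<noteq> 0 \<longrightarrow> 0 < b x x)"

definition ip_norm :: "('a::real_vector \<Rightarrow> 'a \<Rightarrow> real) \<Rightarrow> 'a \<Rightarrow> real" where
  "ip_norm b x = sqrt (b x x)"

(* Meaningful only for nonempty A, because Inf on the reals is unspecified on the empty set. *)
definition ip_infdist :: "('a::real_vector \<Rightarrow> 'a \<Rightarrow> real) \<Rightarrow> 'a \<Rightarrow> 'a set \<Rightarrow> real" where
  "ip_infdist b x A = (INF y\<in>A. ip_norm b (x - y))"

end

theory Submission
  imports Defs
begin

text \<open>For a frozen state, write \<open>a\<close> for the distance of the slow variable to its fixed-point set and \<open>c\<close> for the
distance of the fast variable to its equilibrium set. One step of the recursion satisfies, in expectation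
over the noise,
\<open>a' \<le> (1 - \<delta> * cS) * a + \<delta> * LS * c\<close> and
\<open>c' \<le> \<delta> * LFIX * LR * a + (cF + \<delta> * LFIX * LS) * c\<close>.

The first inequality comes from averagedness: moving by \<open>R\<close> reduces the squared distance to any
fixed point by a multiple of the squared step, and the error bound says that the expected step is
comparable with the distance (\<open>averaged_step_contraction\<close>). A step of size \<open>\<delta>\<close> interpolates between this
and doing nothing, and replacing \<open>R\<close> by \<open>S\<close> costs \<open>\<delta> * LS * c\<close>. The second inequality combines the
contraction of \<open>F\<close> with the displacement of the equilibrium set when the slow variable moves; this
displacement is at most \<open>LFIX\<close> times the slow increment (\<open>ip_infdist_triangle\<close>).

The bound on \<open>\<delta>\<close> is the small-gain condition for this pair of inequalities: it provides a weight
\<open>p > 0\<close> for which \<open>V = p * a + c\<close> decreases in expectation by a fixed factor \<open>\<rho> < 1\<close>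
(\<open>small_gain\<close>). Each state depends on past noise only and is independent of the present one, so Fubini's
theorem turns the drift for frozen states into geometric decay along trajectories (\<open>iid_geometric_drift\<close>).
Comparing \<open>V\<close> with the Euclidean norm of the two distances gives the claim.\<close>

section \<open>Norms and distances of an inner product\<close>

lemma inner_product_add_sq:
  assumes "inner_product b"
  shows "b (x + y) (x + y) = b x x + 2 * b x y + b y y"
  using assms unfolding inner_product_def
  by (simp add: bilinear_ladd bilinear_radd)

lemma inner_product_diff_scale_sq:
  assumes "inner_product b"
  shows "b (x - t *\<^sub>R y) (x - t *\<^sub>R y) = b x x - 2 * t * b x y + t\<^sup>2 * b y y"
  using assms unfolding inner_product_def
  by (simp add: bilinear_lsub bilinear_rsub bilinear_lmul bilinear_rmul power2_eq_square algebra_simps)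

lemma inner_product_zero [simp]: "inner_product b \<Longrightarrow> b 0 0 = 0"
  unfolding inner_product_def by (simp add: bilinear_lzero)

lemma inner_product_nonneg: "inner_product b \<Longrightarrow> 0 \<le> b x x"
  by (cases "x = 0") (auto simp: inner_product_def less_imp_le bilinear_lzero)

lemma ip_norm_nonneg: "inner_product b \<Longrightarrow> 0 \<le> ip_norm b x"
  by (simp add: ip_norm_def inner_product_nonneg)

lemma ip_norm_sq: "inner_product b \<Longrightarrow> (ip_norm b x)\<^sup>2 = b x x"
  by (simp add: ip_norm_def inner_product_nonneg)

lemma ip_norm_zero: "inner_product b \<Longrightarrow> ip_norm b 0 = 0"
  by (simp add: ip_norm_def)

lemma ip_norm_pos: "inner_product b \<Longrightarrow> x \<noteq> 0 \<Longrightarrow> 0 < ip_norm b x"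
  by (simp add: ip_norm_def inner_product_def)

lemma ip_norm_scale: "inner_product b \<Longrightarrow> ip_norm b (t *\<^sub>R x) = \<bar>t\<bar> * ip_norm b x"
  unfolding ip_norm_def inner_product_def
  by (simp add: bilinear_lmul bilinear_rmul real_sqrt_mult flip: mult.assoc)

lemma ip_norm_minus_commute: "inner_product b \<Longrightarrow> ip_norm b (x - y) = ip_norm b (y - x)"
  using ip_norm_scale[of b "-1" "x - y"] by simp

lemma ip_norm_Cauchy_Schwarz:
  assumes b: "inner_product b"
  shows "b x y \<le> ip_norm b x * ip_norm b y"
proof (cases "y = 0")
  case True
  with b show ?thesis by (simp add: inner_product_def bilinear_rzero bilinear_lzero ip_norm_def)
next
  case False
  then have pos: "0 < b y y" using b by (simp add: inner_product_def)
  have "0 \<le> b x x - 2 * (b x y / b y y) * b x y + (b x y / b y y)\<^sup>2 * b y y"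
    using inner_product_nonneg[OF b] inner_product_diff_scale_sq[OF b] by metis
  also have "\<dots> = b x x - (b x y)\<^sup>2 / b y y"
    using pos by (simp add: field_simps power2_eq_square)
  finally have "(b x y)\<^sup>2 \<le> b x x * b y y"
    using pos by (simp add: field_simps)
  also have "\<dots> = (ip_norm b x * ip_norm b y)\<^sup>2"
    by (simp add: power_mult_distrib ip_norm_sq b)
  finally show ?thesis
    by (rule power2_le_imp_le) (simp add: ip_norm_nonneg b)
qed

lemma ip_norm_triangle:
  assumes b: "inner_product b"
  shows "ip_norm b (x + y) \<le> ip_norm b x + ip_norm b y"
proof (rule power2_le_imp_le)
  show "(ip_norm b (x + y))\<^sup>2 \<le> (ip_norm b x + ip_norm b y)\<^sup>2"
    using ip_norm_Cauchy_Schwarz[OF b, of x y]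
    by (simp add: ip_norm_sq b inner_product_add_sq power2_sum)
qed (simp add: ip_norm_nonneg b)

lemma ip_norm_diff_triangle:
  assumes b: "inner_product b"
  shows "ip_norm b (x - z) \<le> ip_norm b (x - y) + ip_norm b (y - z)"
  using ip_norm_triangle[OF b, of "x - y" "y - z"] by simp

lemma continuous_on_ip_norm [continuous_intros]:
  fixes b :: "'a::euclidean_space \<Rightarrow> 'a \<Rightarrow> real"
  assumes b: "inner_product b" and f: "continuous_on A f"
  shows "continuous_on A (\<lambda>x. ip_norm b (f x))"
proof -
  have "bounded_bilinear b"
    using b by (simp add: inner_product_def bilinear_conv_bounded_bilinear)
  then show ?thesis
    unfolding ip_norm_def
    by (intro continuous_on_real_sqrt bounded_bilinear.continuous_on[of b] f)
qed

text \<open>The unit sphere is compact, so the induced norm has a positive minimum on it. Sublevel sets of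
the induced norm are therefore bounded, which is what makes infima attained below.\<close>

lemma ip_norm_ge_norm:
  fixes b :: "'a::euclidean_space \<Rightarrow> 'a \<Rightarrow> real"
  assumes b: "inner_product b"
  obtains c where "0 < c" "\<And>x. c * norm x \<le> ip_norm b x"
proof -
  obtain u :: 'a where u: "u \<in> sphere 0 1" "\<And>x. x \<in> sphere 0 1 \<Longrightarrow> ip_norm b u \<le> ip_norm b x"
    using continuous_attains_inf[OF compact_sphere, of 0 1 "ip_norm b"]
      continuous_on_ip_norm[OF b continuous_on_id, of "sphere 0 1"] by auto
  have "ip_norm b u * norm x \<le> ip_norm b x" for x
  proof (cases "x = 0")
    case False
    have "ip_norm b u \<le> ip_norm b ((1 / norm x) *\<^sub>R x)"
      using False by (intro u(2)) simp
    then show ?thesis using False by (simp add: ip_norm_scale b field_simps)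
  qed (simp add: ip_norm_zero b)
  moreover have "0 < ip_norm b u" using u(1) by (intro ip_norm_pos b) auto
  ultimately show ?thesis using that by blast
qed

lemma ip_infdist_le: "inner_product b \<Longrightarrow> y \<in> A \<Longrightarrow> ip_infdist b x A \<le> ip_norm b (x - y)"
  unfolding ip_infdist_def
  by (rule cINF_lower) (auto intro!: bdd_belowI2[of _ 0] ip_norm_nonneg)

lemma ip_infdist_nonneg: "inner_product b \<Longrightarrow> A \<noteq> {} \<Longrightarrow> 0 \<le> ip_infdist b x A"
  unfolding ip_infdist_def by (rule cINF_greatest) (auto intro: ip_norm_nonneg)

text \<open>A nearest point exists because the search can be confined to a closed ball, which is compact. Working
with a nearest point allows one and the same point of the set to be used for every value of the
noise, which an infimum taken separately at each value would not.\<close>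

lemma ip_infdist_attained:
  fixes b :: "'a::euclidean_space \<Rightarrow> 'a \<Rightarrow> real"
  assumes b: "inner_product b" and A: "closed A" "A \<noteq> {}"
  obtains y where "y \<in> A" "ip_norm b (x - y) = ip_infdist b x A"
proof -
  obtain y0 where y0: "y0 \<in> A" using A by blast
  obtain c where c: "0 < c" "\<And>x. c * norm x \<le> ip_norm b x" using ip_norm_ge_norm[OF b] by blast
  define r where "r = ip_norm b (x - y0) / c"
  have near: "y \<in> cball x r" if "ip_norm b (x - y) \<le> ip_norm b (x - y0)" for y
    using c(2)[of "x - y"] that c(1) by (simp add: r_def dist_norm field_simps)
  have "continuous_on (A \<inter> cball x r) (\<lambda>y. ip_norm b (x - y))"
    by (intro continuous_intros b)
  moreover have "compact (A \<inter> cball x r)" "A \<inter> cball x r \<noteq> {}"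
    using A near[of y0] y0 by (auto intro: closed_Int_compact)
  ultimately obtain y where y: "y \<in> A \<inter> cball x r"
      "\<And>y'. y' \<in> A \<inter> cball x r \<Longrightarrow> ip_norm b (x - y) \<le> ip_norm b (x - y')"
    using continuous_attains_inf[of "A \<inter> cball x r" "\<lambda>y. ip_norm b (x - y)"] by blast
  have "ip_norm b (x - y) \<le> ip_norm b (x - y')" if "y' \<in> A" for y'
    using y(2)[of y'] y(2)[of y0] near[of y'] near[of y0] y0 that by force
  then have "ip_norm b (x - y) \<le> ip_infdist b x A"
    unfolding ip_infdist_def using A by (intro cINF_greatest) auto
  with ip_infdist_le[OF b, of y A x] y(1) show ?thesis by (intro that[of y]) auto
qed

text \<open>Go from \<^term>\<open>x'\<close> to \<^term>\<open>x\<close>, on to the point of \<^term>\<open>A\<close> nearest to \<^term>\<open>x\<close>, and from there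
to \<^term>\<open>B\<close>. With \<^term>\<open>A\<close> and \<^term>\<open>B\<close> two values of a set-valued map, \<^term>\<open>k\<close> is the price of a moving
target.\<close>

lemma ip_infdist_triangle:
  fixes b :: "'a::euclidean_space \<Rightarrow> 'a \<Rightarrow> real"
  assumes b: "inner_product b" and A: "closed A" "A \<noteq> {}"
    and close: "\<And>y. y \<in> A \<Longrightarrow> ip_infdist b y B \<le> k" and B: "closed B" "B \<noteq> {}"
  shows "ip_infdist b x' B \<le> ip_norm b (x' - x) + ip_infdist b x A + k"
proof -
  obtain y where y: "y \<in> A" "ip_norm b (x - y) = ip_infdist b x A"
    using ip_infdist_attained[OF b A] .
  obtain v where v: "v \<in> B" "ip_norm b (y - v) = ip_infdist b y B"
    using ip_infdist_attained[OF b B] .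
  have "ip_infdist b x' B \<le> ip_norm b (x' - v)" by (rule ip_infdist_le[OF b v(1)])
  also have "\<dots> \<le> ip_norm b (x' - x) + (ip_norm b (x - y) + ip_norm b (y - v))"
    using ip_norm_diff_triangle[OF b, of x' v x] ip_norm_diff_triangle[OF b, of x v y] by linarith
  finally show ?thesis using y v close by fastforce
qed

text \<open>A Lipschitz bound on the excess of one value of the set-valued map over another suffices, because it
can be applied in both directions. Continuity provides the measurability of the distance to a
moving target along random trajectories.\<close>

lemma continuous_on_set_valued_infdist:
  fixes bF :: "'b::euclidean_space \<Rightarrow> 'b \<Rightarrow> real" and bS :: "'a::euclidean_space \<Rightarrow> 'a \<Rightarrow> real"
  assumes bS: "inner_product bS" and bF: "inner_product bF" and L: "0 \<le> L"
    and A: "\<And>x. x \<in> X \<Longrightarrow> closed (A x)" "\<And>x. x \<in> X \<Longrightarrow> A x \<noteq> {}"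
    and Lip: "\<And>x x' y. x \<in> X \<Longrightarrow> x' \<in> X \<Longrightarrow> y \<in> A x \<Longrightarrow>
                ip_infdist bF y (A x') \<le> L * ip_norm bS (x - x')"
  shows "continuous_on (X \<times> UNIV) (\<lambda>(x, z). ip_infdist bF z (A x))"
proof -
  let ?f = "\<lambda>(x, z). ip_infdist bF z (A x)"
  define g where "g s s' = ip_norm bF (snd s' - snd s) + L * ip_norm bS (fst s' - fst s)" for s s'
  have one: "?f s' \<le> ?f s + g s s'" if "s \<in> X \<times> UNIV" "s' \<in> X \<times> UNIV" for s s'
  proof -
    have "ip_infdist bF (snd s') (A (fst s'))
        \<le> ip_norm bF (snd s' - snd s) + ip_infdist bF (snd s) (A (fst s)) + L * ip_norm bS (fst s - fst s')"
      using that by (intro ip_infdist_triangle bF A Lip) auto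
    then show ?thesis
      by (simp add: g_def case_prod_beta ip_norm_minus_commute[OF bS, of "fst s"])
  qed
  have sym: "g s s' = g s' s" for s s'
    unfolding g_def using ip_norm_minus_commute[OF bS] ip_norm_minus_commute[OF bF] by metis
  show ?thesis
    unfolding continuous_on_def
  proof
    fix s assume s: "s \<in> X \<times> (UNIV :: 'b set)"
    have "continuous_on UNIV (g s)"
      unfolding g_def by (intro continuous_intros bS bF)
    then have "(g s \<longlongrightarrow> g s s) (at s within X \<times> UNIV)"
      by (meson continuous_on_def tendsto_within_subset UNIV_I subset_UNIV)
    then have g0: "(g s \<longlongrightarrow> 0) (at s within X \<times> UNIV)"
      by (simp add: g_def ip_norm_zero bS bF)
    have "\<forall>\<^sub>F s' in at s within X \<times> UNIV. norm (?f s' - ?f s) \<le> g s s'"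
      using one[OF s] one[OF _ s] sym[of s]
      by (auto simp: eventually_at_filter abs_le_iff intro!: always_eventually) (smt (verit) SigmaI UNIV_I)+
    from Lim_null_comparison[OF this g0] show "(?f \<longlongrightarrow> ?f s) (at s within X \<times> UNIV)"
      by (simp add: LIM_zero_cancel)
  qed
qed

lemma continuous_on_ip_infdist:
  fixes b :: "'a::euclidean_space \<Rightarrow> 'a \<Rightarrow> real"
  assumes b: "inner_product b" and A: "closed A" "A \<noteq> {}"
  shows "continuous_on T (\<lambda>x. ip_infdist b x A)"
proof -
  have "ip_infdist b y A \<le> 0" if "y \<in> A" for y
    using ip_infdist_le[OF b that, of y] by (simp add: ip_norm_zero b)
  then have "continuous_on (T \<times> UNIV) (\<lambda>(x, z). ip_infdist b z A)"
    using continuous_on_set_valued_infdist[OF b b order_refl, of T "\<lambda>_. A"] A by simp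
  moreover have "continuous_on T (\<lambda>x. (x, x))" by (intro continuous_intros)
  ultimately show ?thesis
    using continuous_on_compose2[of "T \<times> UNIV" "\<lambda>(x, z). ip_infdist b z A" T "\<lambda>x. (x, x)"] by auto
qed

section \<open>Contraction of an averaged step in expectation\<close>

text \<open>Expanding the nonexpansiveness hypothesis bounds the cross term by
\<^term>\<open>2 * b e v \<le> - b v v / \<alpha>\<close>; inserting this into the expansion of the full step leaves a decrease
proportional to the squared length of the step.\<close>

lemma averaged_step_sq:
  assumes b: "inner_product b" and "0 < \<alpha>"
    and nonexp: "ip_norm b (e + (1 / \<alpha>) *\<^sub>R v) \<le> ip_norm b e"
  shows "(ip_norm b (e + v))\<^sup>2 + (1 - \<alpha>) / \<alpha> * (ip_norm b v)\<^sup>2 \<le> (ip_norm b e)\<^sup>2"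
proof -
  have "(ip_norm b (e + (1 / \<alpha>) *\<^sub>R v))\<^sup>2 \<le> (ip_norm b e)\<^sup>2"
    by (rule power_mono[OF nonexp ip_norm_nonneg[OF b]])
  moreover have "(ip_norm b (e + (1 / \<alpha>) *\<^sub>R v))\<^sup>2
      = b e e + 2 * (1 / \<alpha>) * b e v + (1 / \<alpha>)\<^sup>2 * b v v"
    using inner_product_diff_scale_sq[OF b, of e "- (1 / \<alpha>)" v] by (simp add: ip_norm_sq b)
  ultimately have "2 * (1 / \<alpha>) * b e v + (1 / \<alpha>)\<^sup>2 * b v v \<le> 0"
    by (simp add: ip_norm_sq b)
  moreover have "2 * (1 / \<alpha>) * b e v + (1 / \<alpha>)\<^sup>2 * b v v = (2 * b e v + b v v / \<alpha>) / \<alpha>"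
    by (simp add: add_divide_distrib power2_eq_square)
  ultimately have "2 * b e v + b v v / \<alpha> \<le> 0"
    using \<open>0 < \<alpha>\<close> by (simp add: divide_le_0_iff)
  then show ?thesis
    using \<open>0 < \<alpha>\<close> by (simp add: ip_norm_sq b inner_product_add_sq diff_divide_distrib left_diff_distrib)
qed

lemma (in prob_space) expectation_sq_le:
  fixes f :: "'a \<Rightarrow> real"
  assumes "integrable M f" "integrable M (\<lambda>\<omega>. (f \<omega>)\<^sup>2)"
  shows "(expectation f)\<^sup>2 \<le> expectation (\<lambda>\<omega>. (f \<omega>)\<^sup>2)"
  using variance_eq[OF assms] variance_positive[of f] by simp

text \<open>The decrease of the squared error is proportional to the expected squared step. By Jensen's
inequality it is at least proportional to the squared expected step, and the error bound compares the
latter with the squared error itself. When the radicand is negative, the estimate of the squared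
expectation forces \<^term>\<open>ip_norm b e = 0\<close>; the computation covers this case as well, since
\<^term>\<open>sqrt\<close> is odd, monotone and multiplicative on all reals.\<close>

lemma (in prob_space) averaged_step_contraction:
  fixes b :: "'v::euclidean_space \<Rightarrow> 'v \<Rightarrow> real"
  assumes b: "inner_product b" and v[measurable]: "random_variable borel v"
    and \<alpha>: "0 < \<alpha>" "\<alpha> < 1" and \<mu>: "0 < \<mu>"
    and nonexp: "\<And>\<omega>. \<omega> \<in> space M \<Longrightarrow> ip_norm b (e + (1 / \<alpha>) *\<^sub>R v \<omega>) \<le> ip_norm b e"
    and error: "ip_norm b e \<le> \<mu> * expectation (\<lambda>\<omega>. ip_norm b (v \<omega>))"
  shows "integrable M (\<lambda>\<omega>. ip_norm b (e + v \<omega>))"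
    and "expectation (\<lambda>\<omega>. ip_norm b (e + v \<omega>))
        \<le> sqrt (1 - (1 - \<alpha>) / (\<alpha> * \<mu>\<^sup>2)) * ip_norm b e"
proof -
  let ?E = "ip_norm b e" and ?k = "(1 - \<alpha>) / \<alpha>"
  have k: "0 \<le> ?k" using \<alpha> by simp
  have [measurable]: "ip_norm b \<in> borel_measurable borel"
    by (intro borel_measurable_continuous_onI continuous_intros b)
  have sq: "(ip_norm b (e + v \<omega>))\<^sup>2 + ?k * (ip_norm b (v \<omega>))\<^sup>2 \<le> ?E\<^sup>2" if "\<omega> \<in> space M" for \<omega>
    using averaged_step_sq[OF b \<alpha>(1) nonexp[OF that]] .
  have le1: "ip_norm b (e + v \<omega>) \<le> ?E" if "\<omega> \<in> space M" for \<omega>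
  proof (rule power2_le_imp_le)
    show "(ip_norm b (e + v \<omega>))\<^sup>2 \<le> ?E\<^sup>2"
      using sq[OF that] mult_nonneg_nonneg[OF k zero_le_power2[of "ip_norm b (v \<omega>)"]] by linarith
  qed (rule ip_norm_nonneg[OF b])
  have le2: "ip_norm b (v \<omega>) \<le> 2 * ?E" if "\<omega> \<in> space M" for \<omega>
    using le1[OF that] ip_norm_triangle[OF b, of "e + v \<omega>" "- e"] ip_norm_minus_commute[OF b, of 0 e]
    by simp
  note nn = ip_norm_nonneg[OF b]
  have int1: "integrable M (\<lambda>\<omega>. ip_norm b (e + v \<omega>))"
    using le1 by (intro integrable_const_bound[where B = ?E]) (auto simp: nn)
  have int2: "integrable M (\<lambda>\<omega>. ip_norm b (v \<omega>))"
    using le2 by (intro integrable_const_bound[where B = "2 * ?E"]) (auto simp: nn)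
  have int1': "integrable M (\<lambda>\<omega>. (ip_norm b (e + v \<omega>))\<^sup>2)"
    using le1 by (intro integrable_const_bound[where B = "?E\<^sup>2"]) (auto simp: nn power_mono)
  have int2': "integrable M (\<lambda>\<omega>. (ip_norm b (v \<omega>))\<^sup>2)"
    using power_mono[OF le2 nn, of _ 2] by (intro integrable_const_bound[where B = "(2 * ?E)\<^sup>2"]) auto
  let ?A = "expectation (\<lambda>\<omega>. ip_norm b (e + v \<omega>))" and ?B = "expectation (\<lambda>\<omega>. ip_norm b (v \<omega>))"
  have "?A\<^sup>2 + ?k * ?B\<^sup>2
      \<le> expectation (\<lambda>\<omega>. (ip_norm b (e + v \<omega>))\<^sup>2) + ?k * expectation (\<lambda>\<omega>. (ip_norm b (v \<omega>))\<^sup>2)"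
    by (intro add_mono mult_left_mono expectation_sq_le int1 int2 int1' int2' k)
  also have "\<dots> = expectation (\<lambda>\<omega>. (ip_norm b (e + v \<omega>))\<^sup>2 + ?k * (ip_norm b (v \<omega>))\<^sup>2)"
    using int1' int2' by simp
  also have "\<dots> \<le> expectation (\<lambda>\<omega>. ?E\<^sup>2)"
    using sq int1' int2' by (intro integral_mono) auto
  finally have upper: "?A\<^sup>2 + ?k * ?B\<^sup>2 \<le> ?E\<^sup>2" by (simp add: prob_space)
  have "?E / \<mu> \<le> ?B" using error \<mu> by (simp add: field_simps)
  then have "(?E / \<mu>)\<^sup>2 \<le> ?B\<^sup>2" using \<mu> by (intro power_mono) (auto simp: nn)
  from mult_left_mono[OF this k] upper
  have "?A\<^sup>2 \<le> ?E\<^sup>2 - ?k * (?E / \<mu>)\<^sup>2" by linarith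
  also have "\<dots> = (1 - (1 - \<alpha>) / (\<alpha> * \<mu>\<^sup>2)) * ?E\<^sup>2"
    by (simp add: power_divide left_diff_distrib)
  finally have "sqrt (?A\<^sup>2) \<le> sqrt ((1 - (1 - \<alpha>) / (\<alpha> * \<mu>\<^sup>2)) * ?E\<^sup>2)"
    by (rule real_sqrt_le_mono)
  then have "\<bar>?A\<bar> \<le> sqrt (1 - (1 - \<alpha>) / (\<alpha> * \<mu>\<^sup>2)) * ?E"
    by (simp add: real_sqrt_mult nn)
  then show "?A \<le> sqrt (1 - (1 - \<alpha>) / (\<alpha> * \<mu>\<^sup>2)) * ?E" by linarith
  show "integrable M (\<lambda>\<omega>. ip_norm b (e + v \<omega>))" by (rule int1)
qed

section \<open>Geometric drift along i.i.d. driven recursions\<close>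

text \<open>The state as an explicit function of the noise history: it reads only the first \<open>t\<close> entries, so
it is measurable with respect to the past and independent of the present noise.\<close>

primrec orbit :: "('s \<times> 'q \<Rightarrow> 's) \<Rightarrow> 's \<Rightarrow> (nat \<Rightarrow> 'q) \<Rightarrow> nat \<Rightarrow> 's" where
  "orbit \<Phi> s0 w 0 = s0"
| "orbit \<Phi> s0 w (Suc t) = \<Phi> (orbit \<Phi> s0 w t, w t)"

lemma orbit_cong: "(\<And>i. i < t \<Longrightarrow> w i = w' i) \<Longrightarrow> orbit \<Phi> s0 w t = orbit \<Phi> s0 w' t"
  by (induction t) auto

lemma orbit_measurable:
  assumes \<Phi>: "\<Phi> \<in> N \<Otimes>\<^sub>M Q \<rightarrow>\<^sub>M N" and s0: "s0 \<in> space N"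
  shows "{..<t} \<subseteq> I \<Longrightarrow> (\<lambda>w. orbit \<Phi> s0 w t) \<in> Pi\<^sub>M I (\<lambda>_. Q) \<rightarrow>\<^sub>M N"
proof (induction t)
  case 0
  then show ?case using s0 by simp
next
  case (Suc t)
  have "(\<lambda>w. orbit \<Phi> s0 w t) \<in> Pi\<^sub>M I (\<lambda>_. Q) \<rightarrow>\<^sub>M N"
    using Suc by (simp add: lessThan_Suc)
  moreover have "(\<lambda>w. w t) \<in> Pi\<^sub>M I (\<lambda>_. Q) \<rightarrow>\<^sub>M Q"
    using Suc.prems by (intro measurable_component_singleton) auto
  ultimately have "(\<lambda>w. (orbit \<Phi> s0 w t, w t)) \<in> Pi\<^sub>M I (\<lambda>_. Q) \<rightarrow>\<^sub>M N \<Otimes>\<^sub>M Q"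
    by (rule measurable_Pair)
  from measurable_compose[OF this \<Phi>] show ?case by simp
qed

text \<open>Independence makes the joint law a product measure, so the present noise may be integrated out first
with the past frozen.\<close>

lemma (in prob_space) nn_integral_indep_var:
  assumes ind: "indep_var N Y Q q" and h: "h \<in> borel_measurable (N \<Otimes>\<^sub>M Q)"
  shows "(\<integral>\<^sup>+ \<omega>. h (Y \<omega>, q \<omega>) \<partial>M) = (\<integral>\<^sup>+ \<omega>. (\<integral>\<^sup>+ \<omega>'. h (Y \<omega>, q \<omega>') \<partial>M) \<partial>M)"
proof -
  have Y[measurable]: "random_variable N Y" and q[measurable]: "random_variable Q q"
    and prod: "distr M N Y \<Otimes>\<^sub>M distr M Q q = distr M (N \<Otimes>\<^sub>M Q) (\<lambda>\<omega>. (Y \<omega>, q \<omega>))"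
    using ind by (simp_all add: indep_var_distribution_eq)
  note h[measurable]
  interpret law: prob_space "distr M Q q" using q by (rule prob_space_distr)
  have "(\<integral>\<^sup>+ \<omega>. h (Y \<omega>, q \<omega>) \<partial>M) = (\<integral>\<^sup>+ u. h u \<partial>(distr M N Y \<Otimes>\<^sub>M distr M Q q))"
    unfolding prod by (subst nn_integral_distr) measurable
  also have "\<dots> = (\<integral>\<^sup>+ y. (\<integral>\<^sup>+ v. h (y, v) \<partial>distr M Q q) \<partial>distr M N Y)"
    by (rule law.nn_integral_fst[symmetric]) simp
  also have "\<dots> = (\<integral>\<^sup>+ \<omega>. (\<integral>\<^sup>+ v. h (Y \<omega>, v) \<partial>distr M Q q) \<partial>M)"
    by (intro nn_integral_distr) simp_all
  also have "\<dots> = (\<integral>\<^sup>+ \<omega>. (\<integral>\<^sup>+ \<omega>'. h (Y \<omega>, q \<omega>') \<partial>M) \<partial>M)"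
  proof (intro nn_integral_cong nn_integral_distr q)
    fix \<omega> assume "\<omega> \<in> space M"
    then have [measurable]: "Y \<omega> \<in> space N" using measurable_space[OF Y] by blast
    show "(\<lambda>v. h (Y \<omega>, v)) \<in> borel_measurable (distr M Q q)" by measurable
  qed
  finally show ?thesis .
qed

text \<open>A drift inequality for frozen states propagates along the trajectory: conditionally on the past, the
current noise has the common law, so one step costs a factor \<^term>\<open>\<rho>\<close>. Extended nonnegative
values of \<^term>\<open>V\<close> avoid any a priori integrability.\<close>

lemma (in prob_space) iid_geometric_drift:
  fixes r :: "nat \<Rightarrow> 'a \<Rightarrow> 'q" and s :: "nat \<Rightarrow> 'a \<Rightarrow> 's" and V :: "'s \<Rightarrow> ennreal"
  assumes indep: "indep_vars (\<lambda>_. Q) r UNIV"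
    and ident: "\<And>t. distr M Q (r t) = distr M Q (r 0)"
    and \<Phi>: "\<Phi> \<in> N \<Otimes>\<^sub>M Q \<rightarrow>\<^sub>M N" and V: "V \<in> borel_measurable N"
    and K: "K \<subseteq> space N" "\<And>u t \<omega>. u \<in> K \<Longrightarrow> \<omega> \<in> space M \<Longrightarrow> \<Phi> (u, r t \<omega>) \<in> K"
    and drift: "\<And>u. u \<in> K \<Longrightarrow> (\<integral>\<^sup>+ \<omega>. V (\<Phi> (u, r 0 \<omega>)) \<partial>M) \<le> \<rho> * V u"
    and s0: "s0 \<in> K" "\<And>\<omega>. \<omega> \<in> space M \<Longrightarrow> s 0 \<omega> = s0"
    and step: "\<And>t \<omega>. \<omega> \<in> space M \<Longrightarrow> s (Suc t) \<omega> = \<Phi> (s t \<omega>, r t \<omega>)"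
  shows "random_variable N (s t)"
    and "\<omega> \<in> space M \<Longrightarrow> s t \<omega> \<in> K"
    and "(\<integral>\<^sup>+ \<omega>. V (s t \<omega>) \<partial>M) \<le> \<rho> ^ t * V s0"
proof -
  have s0N: "s0 \<in> space N" using s0 K by auto
  have rv: "random_variable Q (r t)" for t
    using indep by (auto simp: indep_vars_def)
  have s_orbit: "s t \<omega> = orbit \<Phi> s0 (\<lambda>i\<in>{..<t}. r i \<omega>) t" if "\<omega> \<in> space M" for t \<omega>
  proof -
    have "s t \<omega> = orbit \<Phi> s0 (\<lambda>i. r i \<omega>) t"
      by (induction t) (simp_all add: s0 step that)
    also have "\<dots> = orbit \<Phi> s0 (\<lambda>i\<in>{..<t}. r i \<omega>) t" by (rule orbit_cong) simp
    finally show ?thesis .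
  qed
  let ?past = "\<lambda>t \<omega>. \<lambda>i\<in>{..<t}. r i \<omega>" and ?now = "\<lambda>t \<omega>. \<lambda>i\<in>{t}. r i \<omega>"
  show rv_s: "random_variable N (s t)" for t
  proof -
    have "?past t \<in> M \<rightarrow>\<^sub>M Pi\<^sub>M {..<t} (\<lambda>_. Q)"
      by (intro measurable_restrict rv)
    from measurable_compose[OF this orbit_measurable[OF \<Phi> s0N order_refl]]
    show ?thesis by (simp add: s_orbit cong: measurable_cong)
  qed
  show s_K: "s t \<omega> \<in> K" if "\<omega> \<in> space M" for t \<omega>
    using that by (induction t) (simp_all add: s0 step K)
  show "(\<integral>\<^sup>+ \<omega>. V (s t \<omega>) \<partial>M) \<le> \<rho> ^ t * V s0"
  proof (induction t)
    case 0
    then show ?case by (simp add: s0 emeasure_space_1 cong: nn_integral_cong)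
  next
    case (Suc t)
    let ?h = "\<lambda>(w, w'). V (\<Phi> (orbit \<Phi> s0 w t, w' t))"
    have h: "?h \<in> borel_measurable (Pi\<^sub>M {..<t} (\<lambda>_. Q) \<Otimes>\<^sub>M Pi\<^sub>M {t} (\<lambda>_. Q))"
    proof -
      note [measurable] = \<Phi> V orbit_measurable[OF \<Phi> s0N order_refl, of t]
      show ?thesis by measurable
    qed
    have "(\<integral>\<^sup>+ \<omega>. V (s (Suc t) \<omega>) \<partial>M) = (\<integral>\<^sup>+ \<omega>. V (\<Phi> (s t \<omega>, r t \<omega>)) \<partial>M)"
      by (simp add: step cong: nn_integral_cong)
    also have "\<dots> = (\<integral>\<^sup>+ \<omega>. ?h (?past t \<omega>, ?now t \<omega>) \<partial>M)"
      by (intro nn_integral_cong) (simp add: s_orbit)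
    also have "\<dots> = (\<integral>\<^sup>+ \<omega>. (\<integral>\<^sup>+ \<omega>'. ?h (?past t \<omega>, ?now t \<omega>') \<partial>M) \<partial>M)"
      by (intro nn_integral_indep_var[OF _ h] indep_var_restrict[OF indep]) auto
    also have "\<dots> = (\<integral>\<^sup>+ \<omega>. (\<integral>\<^sup>+ \<omega>'. V (\<Phi> (s t \<omega>, r t \<omega>')) \<partial>M) \<partial>M)"
      by (intro nn_integral_cong) (simp add: s_orbit)
    also have "\<dots> = (\<integral>\<^sup>+ \<omega>. (\<integral>\<^sup>+ \<omega>'. V (\<Phi> (s t \<omega>, r 0 \<omega>')) \<partial>M) \<partial>M)"
    proof (rule nn_integral_cong)
      fix \<omega> assume "\<omega> \<in> space M"
      then have "s t \<omega> \<in> space N" using s_K K by auto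
      then have meas: "(\<lambda>v. V (\<Phi> (s t \<omega>, v))) \<in> borel_measurable Q"
        using measurable_compose[OF \<Phi> V] by measurable
      show "(\<integral>\<^sup>+ \<omega>'. V (\<Phi> (s t \<omega>, r t \<omega>')) \<partial>M) = (\<integral>\<^sup>+ \<omega>'. V (\<Phi> (s t \<omega>, r 0 \<omega>')) \<partial>M)"
        using nn_integral_distr[OF rv[of t], of "\<lambda>v. V (\<Phi> (s t \<omega>, v))"]
          nn_integral_distr[OF rv[of 0], of "\<lambda>v. V (\<Phi> (s t \<omega>, v))"] meas ident[of t]
        by simp
    qed
    also have "\<dots> \<le> (\<integral>\<^sup>+ \<omega>. \<rho> * V (s t \<omega>) \<partial>M)"
      by (intro nn_integral_mono drift s_K)
    also have "\<dots> = \<rho> * (\<integral>\<^sup>+ \<omega>. V (s t \<omega>) \<partial>M)"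
      using measurable_compose[OF rv_s V] by (rule nn_integral_cmult)
    also have "\<dots> \<le> \<rho> * (\<rho> ^ t * V s0)" by (intro mult_left_mono Suc) simp
    finally show ?case by (simp add: mult.assoc)
  qed
qed

section \<open>The coupled system\<close>

text \<open>The two gain inequalities ask \<^term>\<open>p\<close> to exceed \<^term>\<open>k * LR / cS\<close> and to stay below
\<^term>\<open>(1 - cF - \<delta> * k * LS) / (\<delta> * LS)\<close>. The bound on the step size says precisely that this interval is
nonempty. Any such weight makes both one-step factors less than one, and \<^term>\<open>\<rho>\<close> is the larger of them.\<close>

lemma small_gain:
  fixes \<delta> cS cF k LS LR :: real
  assumes "0 < \<delta>" "0 < cS" "cF < 1" "0 < cF" "0 < k" "0 < LS" "0 < LR"
    and small: "\<delta> < cS * (1 - cF) / (k * LS * (cS + LR))"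
  obtains p \<rho> where "0 < p" "0 < \<rho>" "\<rho> < 1"
    "p * (1 - \<delta> * cS) + \<delta> * k * LR \<le> \<rho> * p"
    "p * (\<delta> * LS) + (cF + \<delta> * k * LS) \<le> \<rho>"
proof -
  have "\<delta> * (k * LS * (cS + LR)) < cS * (1 - cF)"
    using small assms by (simp add: pos_less_divide_eq)
  then have "k * LR / cS < (1 - cF - \<delta> * k * LS) / (\<delta> * LS)"
    using assms by (simp add: field_simps)
  then obtain p where p: "k * LR / cS < p" "p < (1 - cF - \<delta> * k * LS) / (\<delta> * LS)"
    using dense by blast
  have "0 < p" using p(1) assms by (smt (verit) divide_pos_pos mult_pos_pos)
  define \<rho> where "\<rho> = max (1 - \<delta> * cS + \<delta> * k * LR / p) (p * (\<delta> * LS) + (cF + \<delta> * k * LS))"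
  have "\<delta> * (k * LR) < \<delta> * (cS * p)"
    using p(1) assms by (intro mult_strict_left_mono) (simp_all add: field_simps)
  then have "\<delta> * k * LR / p < \<delta> * cS"
    using \<open>0 < p\<close> by (simp add: field_simps)
  moreover have "p * (\<delta> * LS) < 1 - cF - \<delta> * k * LS"
    using p(2) assms by (simp add: field_simps)
  ultimately have "\<rho> < 1" unfolding \<rho>_def by simp
  moreover have "0 < p * (\<delta> * LS) + (cF + \<delta> * k * LS)"
    using \<open>0 < p\<close> assms by (intro add_pos_pos mult_pos_pos) auto
  then have "0 < \<rho>" unfolding \<rho>_def by simp
  moreover have "p * (1 - \<delta> * cS + \<delta> * k * LR / p) \<le> p * \<rho>"
    using \<open>0 < p\<close> unfolding \<rho>_def by (intro mult_left_mono) auto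
  then have "p * (1 - \<delta> * cS) + \<delta> * k * LR \<le> \<rho> * p"
    using \<open>0 < p\<close> by (simp add: distrib_left mult.commute)
  ultimately show ?thesis
    using that[of p \<rho>] \<open>0 < p\<close> unfolding \<rho>_def by simp
qed

lemma norm_vector2_bounds:
  fixes a c :: real
  assumes "0 \<le> a" "0 \<le> c"
  shows "norm (vector [a, c] :: real ^ 2) \<le> a + c"
    and "a \<le> norm (vector [a, c] :: real ^ 2)" and "c \<le> norm (vector [a, c] :: real ^ 2)"
  using assms norm_le_l1_cart[of "vector [a, c] :: real ^ 2"]
    component_le_norm_cart[of "vector [a, c] :: real ^ 2" 1]
    component_le_norm_cart[of "vector [a, c] :: real ^ 2" 2]
  by (simp_all add: sum_2)

theorem theorem3:
  fixes M :: "'w measure"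
    and r :: "nat \<Rightarrow> 'w \<Rightarrow> real ^ 'p"
    and D :: "(real ^ 'p) set"
    and S :: "real ^ 'n \<Rightarrow> real ^ 'm \<Rightarrow> real ^ 'p \<Rightarrow> real ^ 'n"
    and F :: "real ^ 'n \<Rightarrow> real ^ 'm \<Rightarrow> real ^ 'p \<Rightarrow> real ^ 'm"
    and R :: "real ^ 'n \<Rightarrow> real ^ 'p \<Rightarrow> real ^ 'n"
    and ipS :: "real ^ 'n \<Rightarrow> real ^ 'n \<Rightarrow> real"
    and ipF :: "real ^ 'm \<Rightarrow> real ^ 'm \<Rightarrow> real"
    and X Xfix :: "(real ^ 'n) set"
    and Z :: "(real ^ 'm) set"
    and ZFIX :: "real ^ 'n \<Rightarrow> (real ^ 'm) set"
    and LFIX cF LS LR \<alpha> \<mu> cS \<delta>bar :: real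
  assumes ipS: "inner_product ipS"
    and ipF: "inner_product ipF"
    and prob: "prob_space M"
    and complete: "complete_measure M"
    and r_in_D: "\<forall>t. \<forall>\<omega>\<in>space M. r t \<omega> \<in> D"
    and r_indep: "prob_space.indep_vars M (\<lambda>_. borel) r UNIV"
    and r_ident: "\<forall>t. distr M borel (r t) = distr M borel (r 0)"
    and S_meas: "(\<lambda>(x, z, q). S x z q) \<in> borel_measurable borel"
    and F_meas: "(\<lambda>(x, z, q). F x z q) \<in> borel_measurable borel"
    and R_meas: "(\<lambda>(x, q). R x q) \<in> borel_measurable (restrict_space borel (UNIV \<times> D))"
    and X_closed: "closed X"
    and Z_closed: "closed Z"
    and invariant: "\<forall>x\<in>X. \<forall>z\<in>Z. \<forall>q\<in>D. \<forall>\<delta>'\<in>{0..1}. x + \<delta>' *\<^sub>R S x z q \<in> X \<and> F x z q \<in> Z"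
    and ZFIX_set: "\<forall>x\<in>X. ZFIX x \<subseteq> Z \<and> ZFIX x \<noteq> {} \<and> closed (ZFIX x)"
    and ZFIX_fixed: "\<forall>q\<in>D. \<forall>x\<in>X. \<forall>z\<in>ZFIX x. z = F x z q"
    and LFIX_pos: "LFIX > 0"
    and ZFIX_Lipschitz:
      "\<forall>x\<in>X. \<forall>x'\<in>X. \<forall>z\<in>ZFIX x. ip_infdist ipF z (ZFIX x') \<le> LFIX * ip_norm ipS (x - x')"
    and cF: "0 < cF" "cF < 1"
    and F_contract:
      "\<forall>x\<in>X. \<forall>z\<in>Z. integrable M (\<lambda>\<omega>. ip_infdist ipF (F x z (r 0 \<omega>)) (ZFIX x)) \<and>
         (LINT \<omega>|M. ip_infdist ipF (F x z (r 0 \<omega>)) (ZFIX x)) \<le> cF * ip_infdist ipF z (ZFIX x)"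
    and R_eq: "\<forall>x\<in>X. \<forall>z\<in>ZFIX x. \<forall>q\<in>D. R x q = S x z q"
    and LS_pos: "LS > 0"
    and LR_pos: "LR > 0"
    and S_Lipschitz:
      "\<forall>x\<in>X. \<forall>z\<in>Z. \<forall>z'\<in>Z. \<forall>q\<in>D. ip_norm ipS (S x z q - S x z' q) \<le> LS * ip_norm ipF (z - z')"
    and R_Lipschitz:
      "\<forall>x\<in>X. \<forall>x'\<in>X. \<forall>q\<in>D. ip_norm ipS (R x q - R x' q) \<le> LR * ip_norm ipS (x - x')"
    and Xfix_def: "Xfix = {x\<in>X. \<forall>q\<in>D. R x q = 0}"
    and Xfix_nonempty: "Xfix \<noteq> {}"
    and Xfix_closed: "closed Xfix"
    and \<alpha>: "0 < \<alpha>" "\<alpha> < 1"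
    and \<mu>: "1 \<le> \<mu>"
    and R_averaged:
      "\<forall>x\<in>X. \<forall>x'\<in>X. \<forall>q\<in>D.
         ip_norm ipS ((x + (1 / \<alpha>) *\<^sub>R R x q) - (x' + (1 / \<alpha>) *\<^sub>R R x' q)) \<le> ip_norm ipS (x - x')"
    and R_error_bound:
      "\<forall>x\<in>X. ip_infdist ipS x Xfix \<le> \<mu> * (LINT \<omega>|M. ip_norm ipS (R x (r 0 \<omega>)))"
    and cS_def: "cS = 1 - sqrt (1 - (1 - \<alpha>) / (\<alpha> * \<mu>\<^sup>2))"
    and \<delta>bar_def: "\<delta>bar = cS * (1 - cF) / (LFIX * LS * (cS + LR))"
  shows
    "\<forall>\<delta>. 0 < \<delta> \<and> \<delta> < min \<delta>bar 1 \<longrightarrow>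
       (\<exists>C>0. \<exists>\<rho>. 0 < \<rho> \<and> \<rho> < 1 \<and>
         (\<forall>x0\<in>X. \<forall>z0\<in>Z. \<forall>(x :: nat \<Rightarrow> 'w \<Rightarrow> real ^ 'n) (z :: nat \<Rightarrow> 'w \<Rightarrow> real ^ 'm).
            (\<forall>\<omega>\<in>space M. x 0 \<omega> = x0 \<and> z 0 \<omega> = z0 \<and>
               (\<forall>t. x (Suc t) \<omega> = x t \<omega> + \<delta> *\<^sub>R S (x t \<omega>) (z t \<omega>) (r t \<omega>) \<and>
                    z (Suc t) \<omega> = F (x t \<omega>) (z t \<omega>) (r t \<omega>))) \<longrightarrow>
            (\<forall>t. integrable M (\<lambda>\<omega>. ip_infdist ipS (x t \<omega>) Xfix) \<and>
                 integrable M (\<lambda>\<omega>. ip_infdist ipF (z t \<omega>) (ZFIX (x t \<omega>))) \<and>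
                 norm (vector [LINT \<omega>|M. ip_infdist ipS (x t \<omega>) Xfix,
                               LINT \<omega>|M. ip_infdist ipF (z t \<omega>) (ZFIX (x t \<omega>))] :: real ^ 2)
                 \<le> C * \<rho> ^ t *
                   norm (vector [ip_infdist ipS x0 Xfix, ip_infdist ipF z0 (ZFIX x0)] :: real ^ 2))))"
proof (intro allI impI, goal_cases)
  case (1 \<delta>)
  then have \<delta>: "0 < \<delta>" "\<delta> < 1" "\<delta> < \<delta>bar" by auto
  interpret prob_space M by (rule prob)

  have "0 < cS"
  proof -
    have "0 < (1 - \<alpha>) / (\<alpha> * \<mu>\<^sup>2)" using \<alpha> \<mu> by simp
    then show ?thesis by (simp add: cS_def)
  qed
  obtain p \<rho> where p: "0 < p" and \<rho>: "0 < \<rho>" "\<rho> < 1"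
    and gain_x: "p * (1 - \<delta> * cS) + \<delta> * LFIX * LR \<le> \<rho> * p"
    and gain_z: "p * (\<delta> * LS) + (cF + \<delta> * LFIX * LS) \<le> \<rho>"
    using small_gain[OF \<delta>(1) \<open>0 < cS\<close> cF(2,1) LFIX_pos LS_pos LR_pos] \<delta>(3)
    unfolding \<delta>bar_def by blast

  define dX where "dX x = ip_infdist ipS x Xfix" for x
  define dZ where "dZ x z = ip_infdist ipF z (ZFIX x)" for x z
  define V where "V u = p * dX (fst u) + dZ (fst u) (snd u)" for u
  let ?K = "X \<times> Z"
  have dX_nonneg: "0 \<le> dX x" for x
    unfolding dX_def by (intro ip_infdist_nonneg ipS Xfix_nonempty)
  have dZ_nonneg: "0 \<le> dZ x z" if "x \<in> X" for x z
    unfolding dZ_def using ZFIX_set that by (intro ip_infdist_nonneg ipF) auto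
  have rD: "r t \<omega> \<in> D" if "\<omega> \<in> space M" for t \<omega> using r_in_D that by blast
  have step_in: "x + \<delta> *\<^sub>R S x z (r t \<omega>) \<in> X" "F x z (r t \<omega>) \<in> Z"
    if "x \<in> X" "z \<in> Z" "\<omega> \<in> space M" for x z t \<omega>
    using invariant[rule_format, OF that(1,2) rD[OF that(3)], of \<delta> t] \<delta> by auto
  have r_meas[measurable]: "random_variable borel (r t)" for t
    using r_indep by (auto simp: indep_vars_def)

  \<comment> \<open>The Lyapunov drift for a frozen state, integrating over the noise only.\<close>
  have drift: "(\<integral>\<^sup>+ \<omega>. ennreal (V (x + \<delta> *\<^sub>R S x z (r 0 \<omega>), F x z (r 0 \<omega>))) \<partial>M)
      \<le> ennreal \<rho> * ennreal (V (x, z))"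
    if x: "x \<in> X" and z: "z \<in> Z" for x z
  proof -
    obtain x' where x': "x' \<in> Xfix" "ip_norm ipS (x - x') = dX x"
      using ip_infdist_attained[OF ipS Xfix_closed Xfix_nonempty] unfolding dX_def by metis
    obtain z' where z': "z' \<in> ZFIX x" "ip_norm ipF (z - z') = dZ x z"
      using ip_infdist_attained[OF ipF, of "ZFIX x" z] ZFIX_set x unfolding dZ_def by metis
    have x'X: "x' \<in> X" and Rx': "\<And>q. q \<in> D \<Longrightarrow> R x' q = 0" using x' Xfix_def by auto
    have z'Z: "z' \<in> Z" using z' ZFIX_set x by auto
    let ?v = "\<lambda>\<omega>. R x (r 0 \<omega>)"
    have v_meas: "random_variable borel ?v"
    proof -
      \<comment> \<open>At an equilibrium of the fast state, \<^term>\<open>R\<close> is a section of the Borel map \<^term>\<open>S\<close>.\<close>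
      have "(\<lambda>\<omega>. S x z' (r 0 \<omega>)) \<in> borel_measurable M"
        using measurable_compose[OF _ S_meas, of "\<lambda>\<omega>. (x, z', r 0 \<omega>)" M] by simp
      then show ?thesis using R_eq x z' rD by (simp cong: measurable_cong)
    qed
    have nonexp: "ip_norm ipS ((x - x') + (1 / \<alpha>) *\<^sub>R ?v \<omega>) \<le> ip_norm ipS (x - x')"
      if "\<omega> \<in> space M" for \<omega>
    proof -
      have "ip_norm ipS ((x + (1 / \<alpha>) *\<^sub>R ?v \<omega>) - (x' + (1 / \<alpha>) *\<^sub>R R x' (r 0 \<omega>))) \<le> ip_norm ipS (x - x')"
        using R_averaged x x'X rD[OF that] by blast
      then show ?thesis by (simp add: Rx' rD that algebra_simps)
    qed
    have error: "ip_norm ipS (x - x') \<le> \<mu> * expectation (\<lambda>\<omega>. ip_norm ipS (?v \<omega>))"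
      using R_error_bound x x' by (simp add: dX_def)
    define f where "f = (\<lambda>\<omega>. ip_norm ipS ((x - x') + ?v \<omega>))"
    define g where "g = (\<lambda>\<omega>. dZ x (F x z (r 0 \<omega>)))"
    have \<mu>_pos: "0 < \<mu>" using \<mu> by simp
    have f: "integrable M f" "expectation f \<le> (1 - cS) * dX x"
      using averaged_step_contraction[OF ipS v_meas \<alpha> \<mu>_pos nonexp error] x'(2)
      by (simp_all add: f_def cS_def)
    have g: "integrable M g" "expectation g \<le> cF * dZ x z"
      using F_contract x z by (simp_all add: g_def dZ_def)

    have S_close: "ip_norm ipS (S x z (r 0 \<omega>) - ?v \<omega>) \<le> LS * dZ x z" if "\<omega> \<in> space M" for \<omega>
    proof -
      have "?v \<omega> = S x z' (r 0 \<omega>)" using R_eq x z' rD[OF that] by blast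
      then show ?thesis using S_Lipschitz x z z'Z z'(2) rD[OF that] by metis
    qed
    \<comment> \<open>A step of size \<^term>\<open>\<delta>\<close> is a convex combination of no step and a full step, up to the error made by
      a fast state that is not at equilibrium. The nearest point \<^term>\<open>x'\<close> is common to both parts.\<close>
    have slow: "dX (x + \<delta> *\<^sub>R S x z (r 0 \<omega>)) \<le> (1 - \<delta>) * dX x + \<delta> * f \<omega> + \<delta> * LS * dZ x z"
      if "\<omega> \<in> space M" for \<omega>
    proof -
      let ?s = "S x z (r 0 \<omega>)"
      have "x + \<delta> *\<^sub>R ?s - x' = ((1 - \<delta>) *\<^sub>R (x - x') + \<delta> *\<^sub>R ((x - x') + ?v \<omega>)) + \<delta> *\<^sub>R (?s - ?v \<omega>)"
        by (simp add: algebra_simps)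
      then have "ip_norm ipS (x + \<delta> *\<^sub>R ?s - x')
          \<le> ip_norm ipS ((1 - \<delta>) *\<^sub>R (x - x')) + ip_norm ipS (\<delta> *\<^sub>R ((x - x') + ?v \<omega>))
            + ip_norm ipS (\<delta> *\<^sub>R (?s - ?v \<omega>))"
        using ip_norm_triangle[OF ipS] by (smt (verit))
      also have "\<dots> = (1 - \<delta>) * dX x + \<delta> * f \<omega> + \<delta> * ip_norm ipS (?s - ?v \<omega>)"
        using \<delta> x'(2) by (simp add: ip_norm_scale[OF ipS] f_def)
      also have "\<dots> \<le> (1 - \<delta>) * dX x + \<delta> * f \<omega> + \<delta> * (LS * dZ x z)"
        using \<delta> S_close[OF that] by (intro add_left_mono mult_left_mono) auto
      finally show ?thesis
        using ip_infdist_le[OF ipS x'(1), of "x + \<delta> *\<^sub>R ?s"] unfolding dX_def by simp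
    qed
    \<comment> \<open>The contraction of \<^term>\<open>F\<close> is towards the old equilibrium set; the new one has moved by a multiple of
      the slow increment, which is controlled by both distances.\<close>
    have fast: "dZ (x + \<delta> *\<^sub>R S x z (r 0 \<omega>)) (F x z (r 0 \<omega>))
        \<le> g \<omega> + \<delta> * LFIX * LR * dX x + \<delta> * LFIX * LS * dZ x z"
      if "\<omega> \<in> space M" for \<omega>
    proof -
      let ?s = "S x z (r 0 \<omega>)"
      have xs: "x + \<delta> *\<^sub>R ?s \<in> X" using step_in(1)[OF x z that] .
      have "ip_norm ipS (?v \<omega>) \<le> LR * dX x"
        using R_Lipschitz x x'X rD[OF that] Rx' x'(2) by (metis diff_zero)
      then have "ip_norm ipS ?s \<le> LR * dX x + LS * dZ x z"
        using S_close[OF that] ip_norm_triangle[OF ipS, of "?s - ?v \<omega>" "?v \<omega>"] by simp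
      then have s: "LFIX * (\<delta> * ip_norm ipS ?s) \<le> LFIX * (\<delta> * (LR * dX x + LS * dZ x z))"
        using \<delta> LFIX_pos by (intro mult_left_mono) auto
      have Lip: "ip_infdist ipF y (ZFIX (x + \<delta> *\<^sub>R ?s)) \<le> LFIX * ip_norm ipS (x - (x + \<delta> *\<^sub>R ?s))"
        if "y \<in> ZFIX x" for y
        using ZFIX_Lipschitz x xs that by blast
      have "dZ (x + \<delta> *\<^sub>R ?s) (F x z (r 0 \<omega>))
          \<le> ip_norm ipF (F x z (r 0 \<omega>) - F x z (r 0 \<omega>)) + g \<omega> + LFIX * ip_norm ipS (x - (x + \<delta> *\<^sub>R ?s))"
        unfolding dZ_def g_def using ZFIX_set x xs
        by (intro ip_infdist_triangle[OF ipF] Lip) auto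
      also have "\<dots> = g \<omega> + LFIX * (\<delta> * ip_norm ipS ?s)"
        using ip_norm_scale[OF ipS, of "- \<delta>" ?s] \<delta> by (simp add: ip_norm_zero ipF)
      finally show ?thesis using s by (simp add: algebra_simps)
    qed

    define h where "h \<omega> = p * ((1 - \<delta>) * dX x + \<delta> * f \<omega> + \<delta> * LS * dZ x z)
        + (g \<omega> + \<delta> * LFIX * LR * dX x + \<delta> * LFIX * LS * dZ x z)" for \<omega>
    have int_h: "integrable M h" unfolding h_def using f(1) g(1) by simp
    have h_ge: "V (x + \<delta> *\<^sub>R S x z (r 0 \<omega>), F x z (r 0 \<omega>)) \<le> h \<omega>" if "\<omega> \<in> space M" for \<omega>
      unfolding V_def h_def using slow[OF that] fast[OF that] p
      by (auto intro!: add_mono mult_left_mono)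
    have "expectation h = p * ((1 - \<delta>) * dX x + \<delta> * expectation f + \<delta> * LS * dZ x z)
        + (expectation g + \<delta> * LFIX * LR * dX x + \<delta> * LFIX * LS * dZ x z)"
      unfolding h_def using f(1) g(1) by (simp add: prob_space)
    also have "\<dots> \<le> p * ((1 - \<delta>) * dX x + \<delta> * ((1 - cS) * dX x) + \<delta> * LS * dZ x z)
        + (cF * dZ x z + \<delta> * LFIX * LR * dX x + \<delta> * LFIX * LS * dZ x z)"
      using f(2) g(2) p \<delta> by (intro add_mono mult_left_mono order_refl) auto
    also have "\<dots> = (p * (1 - \<delta> * cS) + \<delta> * LFIX * LR) * dX x
        + (p * (\<delta> * LS) + (cF + \<delta> * LFIX * LS)) * dZ x z"
      by (simp add: algebra_simps)
    also have "\<dots> \<le> \<rho> * p * dX x + \<rho> * dZ x z"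
      using gain_x gain_z dX_nonneg dZ_nonneg[OF x] by (intro add_mono mult_right_mono) auto
    also have "\<dots> = \<rho> * V (x, z)" by (simp add: V_def algebra_simps)
    finally have Eh: "expectation h \<le> \<rho> * V (x, z)" .
    have h_nonneg: "0 \<le> h \<omega>" if "\<omega> \<in> space M" for \<omega>
    proof -
      have "x + \<delta> *\<^sub>R S x z (r 0 \<omega>) \<in> X" using step_in(1)[OF x z that] .
      then show ?thesis
        using h_ge[OF that] dX_nonneg dZ_nonneg p unfolding V_def
        by (smt (verit) fst_conv snd_conv mult_nonneg_nonneg)
    qed
    have "(\<integral>\<^sup>+ \<omega>. ennreal (V (x + \<delta> *\<^sub>R S x z (r 0 \<omega>), F x z (r 0 \<omega>))) \<partial>M) \<le> (\<integral>\<^sup>+ \<omega>. ennreal (h \<omega>) \<partial>M)"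
      by (intro nn_integral_mono ennreal_leI h_ge)
    also have "\<dots> = ennreal (expectation h)"
      using int_h h_nonneg by (intro nn_integral_eq_integral) auto
    also have "\<dots> \<le> ennreal \<rho> * ennreal (V (x, z))"
      using Eh \<rho> by (simp add: ennreal_leI flip: ennreal_mult')
    finally show ?thesis .
  qed

  define \<Phi> where "\<Phi> = (\<lambda>((x, z), q). (x + \<delta> *\<^sub>R S x z q, F x z q))"
  have \<Phi>_meas: "\<Phi> \<in> borel \<Otimes>\<^sub>M borel \<rightarrow>\<^sub>M borel"
  proof -
    have pair: "(\<lambda>u. (fst (fst u), snd (fst u), snd u)) \<in> borel
        \<rightarrow>\<^sub>M (borel :: ((real ^ 'n) \<times> (real ^ 'm) \<times> (real ^ 'p)) measure)"
      by (intro borel_measurable_continuous_onI continuous_intros)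
    have SF: "(\<lambda>u. S (fst (fst u)) (snd (fst u)) (snd u)) \<in> borel \<rightarrow>\<^sub>M borel"
        "(\<lambda>u. F (fst (fst u)) (snd (fst u)) (snd u)) \<in> borel \<rightarrow>\<^sub>M borel"
      using measurable_compose[OF pair S_meas] measurable_compose[OF pair F_meas] by simp_all
    show ?thesis
      unfolding \<Phi>_def case_prod_beta borel_prod
      by (intro borel_measurable_Pair borel_measurable_add borel_measurable_scaleR
          borel_measurable_const SF borel_measurable_continuous_onI continuous_intros)
  qed
  have [measurable]: "?K \<in> sets borel"
    using X_closed Z_closed by (intro borel_closed closed_Times)
  have cont_dX: "continuous_on ?K (\<lambda>u. dX (fst u))"
    unfolding dX_def
    by (rule continuous_on_compose2[OF continuous_on_ip_infdist[OF ipS Xfix_closed Xfix_nonempty, of UNIV]])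
      (auto intro: continuous_intros)
  have cont_dZ: "continuous_on ?K (\<lambda>u. dZ (fst u) (snd u))"
  proof -
    have "continuous_on (X \<times> UNIV) (\<lambda>(x, z). ip_infdist ipF z (ZFIX x))"
      using ZFIX_set ZFIX_Lipschitz LFIX_pos
      by (intro continuous_on_set_valued_infdist[OF ipS ipF, of LFIX]) auto
    then show ?thesis
      unfolding dZ_def case_prod_beta by (rule continuous_on_subset) auto
  qed
  have cont_V: "continuous_on ?K V"
    unfolding V_def by (intro continuous_intros cont_dX cont_dZ)

  \<comment> \<open>The two factors compare \<^term>\<open>V\<close> with the Euclidean norm of the pair of distances, in either direction.\<close>
  define C where "C = (1 / p + 1) * (p + 1)"
  have "0 < C" unfolding C_def using p by (intro mult_pos_pos add_pos_pos) auto
  show ?case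
    unfolding dX_def[symmetric] dZ_def[symmetric]
  proof (rule exI[of _ C], rule conjI[OF \<open>0 < C\<close>], rule exI[of _ \<rho>],
      intro conjI ballI allI impI \<rho>)
    fix x0 z0 t and x :: "nat \<Rightarrow> 'w \<Rightarrow> real ^ 'n" and z :: "nat \<Rightarrow> 'w \<Rightarrow> real ^ 'm"
    assume x0: "x0 \<in> X" and z0: "z0 \<in> Z"
      and traj: "\<forall>\<omega>\<in>space M. x 0 \<omega> = x0 \<and> z 0 \<omega> = z0 \<and>
               (\<forall>t. x (Suc t) \<omega> = x t \<omega> + \<delta> *\<^sub>R S (x t \<omega>) (z t \<omega>) (r t \<omega>) \<and>
                    z (Suc t) \<omega> = F (x t \<omega>) (z t \<omega>) (r t \<omega>))"
    define s where "s t \<omega> = (x t \<omega>, z t \<omega>)" for t \<omega>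
    \<comment> \<open>The continuity of \<^term>\<open>V\<close> is known on the closed set \<^term>\<open>X \<times> Z\<close> only; cutting it off outside makes
      it Borel on the whole space without changing it along trajectories.\<close>
    let ?W = "\<lambda>u. ennreal (indicator ?K u *\<^sub>R V u)"
    have W: "?W \<in> borel_measurable borel"
      using borel_measurable_continuous_on_indicator[OF _ cont_V] by measurable
    have K_step: "\<Phi> (u, r t \<omega>) \<in> ?K" if "u \<in> ?K" "\<omega> \<in> space M" for u t \<omega>
      using that step_in by (auto simp: \<Phi>_def)
    have W_drift: "(\<integral>\<^sup>+ \<omega>. ?W (\<Phi> (u, r 0 \<omega>)) \<partial>M) \<le> \<rho> * ?W u" if "u \<in> ?K" for u
    proof -
      have "(\<integral>\<^sup>+ \<omega>. ?W (\<Phi> (u, r 0 \<omega>)) \<partial>M) = (\<integral>\<^sup>+ \<omega>. ennreal (V (\<Phi> (u, r 0 \<omega>))) \<partial>M)"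
        using K_step[OF that] by (intro nn_integral_cong) simp
      then show ?thesis
        using drift[of "fst u" "snd u"] that by (auto simp: \<Phi>_def)
    qed
    have s_start: "(x0, z0) \<in> ?K" "\<And>\<omega>. \<omega> \<in> space M \<Longrightarrow> s 0 \<omega> = (x0, z0)"
      and s_step: "\<And>t \<omega>. \<omega> \<in> space M \<Longrightarrow> s (Suc t) \<omega> = \<Phi> (s t \<omega>, r t \<omega>)"
      using x0 z0 traj by (simp_all add: s_def \<Phi>_def)
    have K_space: "?K \<subseteq> space borel" by simp
    note decay = iid_geometric_drift[where s = s and K = ?K and V = ?W,
        OF r_indep spec[OF r_ident] \<Phi>_meas W K_space K_step W_drift s_start s_step]
    have s_meas: "random_variable borel (s t)" by (rule decay(1))
    have s_K: "s t \<omega> \<in> ?K" if "\<omega> \<in> space M" for \<omega> using that by (intro decay(2))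
    have s_V: "(\<integral>\<^sup>+ \<omega>. ?W (s t \<omega>) \<partial>M) \<le> ennreal \<rho> ^ t * ?W (x0, z0)" by (rule decay(3))
    have meas: "(\<lambda>\<omega>. \<phi> (s t \<omega>)) \<in> borel_measurable M" if "continuous_on ?K \<phi>" for \<phi> :: "_ \<Rightarrow> real"
    proof -
      have "(\<lambda>\<omega>. indicator ?K (s t \<omega>) *\<^sub>R \<phi> (s t \<omega>)) \<in> borel_measurable M"
        using measurable_compose[OF s_meas borel_measurable_continuous_on_indicator[OF _ that]] by simp
      then show ?thesis using s_K by (simp cong: measurable_cong)
    qed
    have parts: "0 \<le> dX (fst (s t \<omega>))" "0 \<le> dZ (fst (s t \<omega>)) (snd (s t \<omega>))" if "\<omega> \<in> space M" for \<omega>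
      using dX_nonneg dZ_nonneg s_K[OF that] by auto
    have V_nonneg: "0 \<le> V (s t \<omega>)" if "\<omega> \<in> space M" for \<omega>
      using parts[OF that] p by (simp add: V_def)
    have V0: "0 \<le> V (x0, z0)" using dX_nonneg dZ_nonneg x0 p by (simp add: V_def)
    have "(\<integral>\<^sup>+ \<omega>. ennreal (V (s t \<omega>)) \<partial>M) = (\<integral>\<^sup>+ \<omega>. ?W (s t \<omega>) \<partial>M)"
      using s_K by (intro nn_integral_cong) simp
    also have "\<dots> \<le> ennreal (\<rho> ^ t * V (x0, z0))"
      using s_V x0 z0 \<rho> V0 by (simp add: ennreal_mult' ennreal_power)
    finally have nnV: "(\<integral>\<^sup>+ \<omega>. ennreal (V (s t \<omega>)) \<partial>M) \<le> ennreal (\<rho> ^ t * V (x0, z0))" .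
    have int_V: "integrable M (\<lambda>\<omega>. V (s t \<omega>))"
      using nnV V_nonneg
      by (intro integrableI_nonneg meas cont_V) (auto simp: order.strict_trans1)
    have EV: "expectation (\<lambda>\<omega>. V (s t \<omega>)) \<le> \<rho> ^ t * V (x0, z0)"
      using nnV nn_integral_eq_integral[OF int_V] V_nonneg V0 \<rho> by (simp add: ennreal_le_iff)
    have int_pX: "integrable M (\<lambda>\<omega>. p * dX (fst (s t \<omega>)))"
      using parts p by (intro Bochner_Integration.integrable_bound[OF int_V]
          borel_measurable_times borel_measurable_const meas cont_dX) (auto simp: V_def)
    have int_dX: "integrable M (\<lambda>\<omega>. dX (fst (s t \<omega>)))"
      using int_pX p by simp
    have int_dZ: "integrable M (\<lambda>\<omega>. dZ (fst (s t \<omega>)) (snd (s t \<omega>)))"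
      using parts p by (intro Bochner_Integration.integrable_bound[OF int_V] meas cont_dZ) (auto simp: V_def)
    show "integrable M (\<lambda>\<omega>. dX (x t \<omega>))" "integrable M (\<lambda>\<omega>. dZ (x t \<omega>) (z t \<omega>))"
      using int_dX int_dZ by (simp_all add: s_def)
    let ?A = "expectation (\<lambda>\<omega>. dX (x t \<omega>))" and ?B = "expectation (\<lambda>\<omega>. dZ (x t \<omega>) (z t \<omega>))"
    let ?n = "norm (vector [dX x0, dZ x0 z0] :: real ^ 2)"
    have nonneg: "0 \<le> ?A" "0 \<le> ?B"
      using parts by (auto intro!: Bochner_Integration.integral_nonneg_AE simp: s_def)
    have EV_eq: "expectation (\<lambda>\<omega>. V (s t \<omega>)) = p * ?A + ?B"
      unfolding V_def using int_dX int_dZ by (simp add: s_def)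
    have "norm (vector [?A, ?B] :: real ^ 2) \<le> ?A + ?B"
      by (rule norm_vector2_bounds[OF nonneg])
    also have "\<dots> \<le> (1 / p + 1) * (p * ?A + ?B)"
      using p nonneg by (simp add: field_simps)
    also have "\<dots> \<le> (1 / p + 1) * (\<rho> ^ t * V (x0, z0))"
      using EV p unfolding EV_eq by (intro mult_left_mono) auto
    also have "\<dots> \<le> (1 / p + 1) * (\<rho> ^ t * ((p + 1) * ?n))"
    proof -
      have "V (x0, z0) \<le> p * ?n + ?n"
        unfolding V_def using norm_vector2_bounds(2,3)[OF dX_nonneg dZ_nonneg[OF x0]] p
        by (auto intro!: add_mono mult_left_mono)
      then show ?thesis using p \<rho> by (intro mult_left_mono) (auto simp: algebra_simps)
    qed
    finally show "norm (vector [?A, ?B] :: real ^ 2) \<le> C * \<rho> ^ t * ?n"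
      by (simp add: C_def ac_simps)
  qed
qed

end
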